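(* Let $(X,\mathcal{T}_1,\mathcal{T}_2,E)$ be a bi-soft topological space over $X$. If $(X,\mathcal{T}_1,\mathcal{T}_2,E)$ is a pair-wise soft $T_0$-space, then $(X,\mathcal{T}_1\vee\mathcal{T}_2,E)$ is a soft $T_0$-space.
   Context: $X$ is a set (initial universe) and $E$ is a non-empty set of parameters. A soft set $(F,E)$ over $X$ is a map $F:E\to\mathcal{P}(X)$, where $\mathcal{P}(X)$ is the power set of $X$. Unions and intersections of soft sets are taken parameterwise. $\Phi$ denotes the soft set with value $\emptyset$ at every $e\in E$ and $\widetilde{X}$ the soft set with value $X$ at every $e\in E$. For $x\in X$, $x\in(F,E)$ means $x\in F(e)$ for all $e\in E$ (so $x\notin(F,E)$ means $x\notin F(e)$ for some $e\in E$). A soft topology on $X$ is a collection $\mathcal{T}$ of soft sets over $X$ (with parameter set $E$) containing $\Phi$ and $\widetilde{X}$ and closed under arbitrary unions and under intersections of two members; $(X,\mathcal{T},E)$ is then a soft topological space and members of $\mathcal{T}$ are called soft open. A bi-soft topological space $(X,\mathcal{T}_1,\mathcal{T}_2,E)$ consists of two soft topologies $\mathcal{T}_1,\mathcal{T}_2$ on $X$ with the same parameter set $E$. $\mathcal{T}_1\vee\mathcal{T}_2$ denotes the smallest soft topology on $X$ containing $\mathcal{T}_1\cup\mathcal{T}_2$. $(X,\mathcal{T},E)$ is a soft $T_0$-space if for every two distinct points $x,y\in X$ there is a soft open set $(F,E)\in\mathcal{T}$ with $x\in(F,E)$, $y\notin(F,E)$, or a soft open set $(G,E)\in\mathcal{T}$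 with $y\in(G,E)$, $x\notin(G,E)$. $(X,\mathcal{T}_1,\mathcal{T}_2,E)$ is a pair-wise soft $T_0$-space if for every two distinct points of $X$ there is a $\mathcal{T}_1$-soft open set or a $\mathcal{T}_2$-soft open set which contains one of the two points but not the other. *)

theory Defs
  imports "HOL-Library.FuncSet"
begin

text \<open>
  A soft set is an extensional function on \<open>E\<close> (arbitrary but fixed value outside \<open>E\<close>), so that
  HOL equality of soft sets is equality of maps \<open>E \<rightarrow> Pow X\<close>.
\<close>

definition soft_sets :: "'a set \<Rightarrow> 'e set \<Rightarrow> ('e \<Rightarrow> 'a set) set" where
  "soft_sets X E = E \<rightarrow>\<^sub>E Pow X"

definition soft_mem :: "'e set \<Rightarrow> 'a \<Rightarrow> ('e \<Rightarrow> 'a set) \<Rightarrow> bool" where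
  "soft_mem E x F \<longleftrightarrow> (\<forall>e\<in>E. x \<in> F e)"

definition soft_empty :: "'e set \<Rightarrow> 'e \<Rightarrow> 'a set" where
  "soft_empty E = (\<lambda>e\<in>E. {})"

definition soft_whole :: "'a set \<Rightarrow> 'e set \<Rightarrow> 'e \<Rightarrow> 'a set" where
  "soft_whole X E = (\<lambda>e\<in>E. X)"

definition soft_Union :: "'e set \<Rightarrow> ('e \<Rightarrow> 'a set) set \<Rightarrow> 'e \<Rightarrow> 'a set" where
  "soft_Union E S = (\<lambda>e\<in>E. \<Union>F\<in>S. F e)"

definition soft_inter :: "'e set \<Rightarrow> ('e \<Rightarrow> 'a set) \<Rightarrow> ('e \<Rightarrow> 'a set) \<Rightarrow> 'e \<Rightarrow> 'a set" where
  "soft_inter E F G = (\<lambda>e\<in>E. F e \<inter> G e)"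

definition soft_topology :: "'a set \<Rightarrow> 'e set \<Rightarrow> ('e \<Rightarrow> 'a set) set \<Rightarrow> bool" where
  "soft_topology X E T \<longleftrightarrow>
     T \<subseteq> soft_sets X E \<and>
     soft_empty E \<in> T \<and>
     soft_whole X E \<in> T \<and>
     (\<forall>S. S \<subseteq> T \<longrightarrow> soft_Union E S \<in> T) \<and>
     (\<forall>F\<in>T. \<forall>G\<in>T. soft_inter E F G \<in> T)"

definition soft_topological_space :: "'a set \<Rightarrow> ('e \<Rightarrow> 'a set) set \<Rightarrow> 'e set \<Rightarrow> bool" where
  "soft_topological_space X T E \<longleftrightarrow> E \<noteq> {} \<and> soft_topology X E T"

definition bi_soft_topological_space ::
    "'a set \<Rightarrow> ('e \<Rightarrow> 'a set) set \<Rightarrow> ('e \<Rightarrow> 'a set) set \<Rightarrow> 'e set \<Rightarrow> bool" where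
  "bi_soft_topological_space X T1 T2 E \<longleftrightarrow>
     E \<noteq> {} \<and> soft_topology X E T1 \<and> soft_topology X E T2"

definition soft_join ::
    "'a set \<Rightarrow> 'e set \<Rightarrow> ('e \<Rightarrow> 'a set) set \<Rightarrow> ('e \<Rightarrow> 'a set) set \<Rightarrow> ('e \<Rightarrow> 'a set) set" where
  "soft_join X E T1 T2 = \<Inter>{T. soft_topology X E T \<and> T1 \<union> T2 \<subseteq> T}"

definition soft_T0_space :: "'a set \<Rightarrow> ('e \<Rightarrow> 'a set) set \<Rightarrow> 'e set \<Rightarrow> bool" where
  "soft_T0_space X T E \<longleftrightarrow>
     soft_topological_space X T E \<and>
     (\<forall>x\<in>X. \<forall>y\<in>X. x \<noteq> y \<longrightarrow>
        (\<exists>F\<in>T. soft_mem E x F \<and> \<not> soft_mem E y F) \<or>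
        (\<exists>G\<in>T. soft_mem E y G \<and> \<not> soft_mem E x G))"

definition pairwise_soft_T0_space ::
    "'a set \<Rightarrow> ('e \<Rightarrow> 'a set) set \<Rightarrow> ('e \<Rightarrow> 'a set) set \<Rightarrow> 'e set \<Rightarrow> bool" where
  "pairwise_soft_T0_space X T1 T2 E \<longleftrightarrow>
     bi_soft_topological_space X T1 T2 E \<and>
     (\<forall>x\<in>X. \<forall>y\<in>X. x \<noteq> y \<longrightarrow>
        (\<exists>F\<in>T1. (soft_mem E x F \<and> \<not> soft_mem E y F) \<or> (soft_mem E y F \<and> \<not> soft_mem E x F)) \<or>
        (\<exists>F\<in>T2. (soft_mem E x F \<and> \<not> soft_mem E y F) \<or> (soft_mem E y F \<and> \<not> soft_mem E x F)))"

text \<open>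
  The family intersected in \<open>soft_join\<close> is nonempty, and \<open>soft_join\<close> is the least soft topology
  containing both arguments.
\<close>

lemma soft_topology_soft_sets: "soft_topology X E (soft_sets X E)"
proof -
  have "soft_Union E S \<in> soft_sets X E" if "S \<subseteq> soft_sets X E" for S
  proof -
    have "F e \<subseteq> X" if "F \<in> S" "e \<in> E" for F e
      using that \<open>S \<subseteq> soft_sets X E\<close> PiE_mem[of F E "\<lambda>_. Pow X" e]
      by (simp add: soft_sets_def subset_iff)
    then have "(\<Union>F\<in>S. F e) \<in> Pow X" if "e \<in> E" for e
      using that by (simp add: UN_least)
    then show ?thesis
      by (simp add: soft_sets_def soft_Union_def)
  qed
  moreover have "soft_inter E F G \<in> soft_sets X E" if "F \<in> soft_sets X E" for F G
  proof -
    have "F e \<inter> G e \<in> Pow X" if "e \<in> E" for e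
      using PiE_mem[of F E "\<lambda>_. Pow X" e] \<open>F \<in> soft_sets X E\<close> that
      by (simp add: soft_sets_def le_infI1)
    then show ?thesis
      by (simp add: soft_sets_def soft_inter_def)
  qed
  moreover have "soft_empty E \<in> soft_sets X E" "soft_whole X E \<in> soft_sets X E"
    by (simp_all add: soft_sets_def soft_empty_def soft_whole_def)
  ultimately show ?thesis
    by (simp add: soft_topology_def)
qed

lemma soft_topology_soft_join:
  assumes "soft_topology X E T1" "soft_topology X E T2"
  shows "soft_topology X E (soft_join X E T1 T2)"
proof -
  let ?C = "{T. soft_topology X E T \<and> T1 \<union> T2 \<subseteq> T}"
  have "T1 \<union> T2 \<subseteq> soft_sets X E"
    using assms by (simp add: soft_topology_def)
  then have "\<Inter>?C \<subseteq> soft_sets X E"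
    by (intro Inter_lower) (simp add: soft_topology_soft_sets)
  moreover have "soft_Union E S \<in> \<Inter>?C" if S: "S \<subseteq> \<Inter>?C" for S
  proof (rule InterI)
    fix T assume T: "T \<in> ?C"
    then have "S \<subseteq> T"
      using S by (meson Inter_lower order_trans)
    then show "soft_Union E S \<in> T"
      using T by (simp add: soft_topology_def)
  qed
  moreover have "soft_inter E F G \<in> \<Inter>?C" if "F \<in> \<Inter>?C" "G \<in> \<Inter>?C" for F G
  proof (rule InterI)
    fix T assume T: "T \<in> ?C"
    then have "F \<in> T" "G \<in> T"
      using that by (meson InterD)+
    then show "soft_inter E F G \<in> T"
      using T by (simp add: soft_topology_def)
  qed
  moreover have "soft_empty E \<in> \<Inter>?C" "soft_whole X E \<in> \<Inter>?C"
    by (simp_all add: soft_topology_def)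
  ultimately have "soft_topology X E (\<Inter>?C)"
    unfolding soft_topology_def[of X E "\<Inter>?C"] by (intro conjI ballI allI impI)
  then show ?thesis
    by (simp only: soft_join_def)
qed

lemma soft_join_upper: "T1 \<union> T2 \<subseteq> soft_join X E T1 T2"
  unfolding soft_join_def by blast

lemma soft_join_least:
  "soft_topology X E T \<Longrightarrow> T1 \<union> T2 \<subseteq> T \<Longrightarrow> soft_join X E T1 T2 \<subseteq> T"
  unfolding soft_join_def by blast

end

theory Submission
  imports Defs
begin

theorem proposition4:
  fixes X :: "'a set" and E :: "'e set" and T1 T2 :: "('e \<Rightarrow> 'a set) set"
  assumes "bi_soft_topological_space X T1 T2 E"
    and "pairwise_soft_T0_space X T1 T2 E"
  shows "soft_T0_space X (soft_join X E T1 T2) E"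
  unfolding soft_T0_space_def
proof (intro conjI ballI impI)
  show "soft_topological_space X (soft_join X E T1 T2) E"
    using assms(1) soft_topology_soft_join
    unfolding bi_soft_topological_space_def soft_topological_space_def by blast
next
  fix x y assume "x \<in> X" "y \<in> X" "x \<noteq> y"
  \<comment> \<open>A separating soft set of either topology is also open in the join, so the same set
    separates the two points there.\<close>
  then obtain F where "F \<in> T1 \<union> T2"
    and "(soft_mem E x F \<and> \<not> soft_mem E y F) \<or> (soft_mem E y F \<and> \<not> soft_mem E x F)"
    using assms(2) unfolding pairwise_soft_T0_space_def by blast
  moreover from this(1) have "F \<in> soft_join X E T1 T2"
    using soft_join_upper by (rule rev_subsetD)
  ultimately show "(\<exists>F\<in>soft_join X E T1 T2. soft_mem E x F \<and> \<not> soft_mem E y F) \<or>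
      (\<exists>G\<in>soft_join X E T1 T2. soft_mem E y G \<and> \<not> soft_mem E x G)"
    by blast
qed

end
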